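(* Let $X$ be a mean zero random variable with finite, non-zero variance, and let $Y$ be a random variable independent of $X$ having the $X$-zero bias distribution. Then $$\mathbb{E}[Xf(X+Y)]=\mathbb{E}[(X^2-XY)f'(X+Y)]$$ for all Lipschitz functions $f$ and a.e. derivative $f'$ for which these expectations exist.
   Context: For a mean zero random variable $X$ with finite, non-zero variance $\sigma^2$, a random variable $X^*$ has the $X$-zero bias distribution when $\sigma^2\,\mathbb{E}[f'(X^* )]=\mathbb{E}[Xf(X)]$ for all Lipschitz functions $f:\mathbb{R}\to\mathbb{R}$ and any a.e. derivative $f'$ of $f$, whenever these expectations exist. This distribution exists for every such $X$, and is absolutely continuous with density $p_{X^*}(x)=\mathbb{E}[X\mathbf{1}(X>x)]/\sigma^2$. *)

theory Defs
  imports "HOL-Probability.Probability"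
begin

definition ae_derivative :: "(real \<Rightarrow> real) \<Rightarrow> (real \<Rightarrow> real) \<Rightarrow> bool" where
  "ae_derivative f f' \<longleftrightarrow> (AE x in lborel. (f has_real_derivative f' x) (at x))"

definition lipschitz_real :: "(real \<Rightarrow> real) \<Rightarrow> bool" where
  "lipschitz_real f \<longleftrightarrow> (\<exists>L. L-lipschitz_on UNIV f)"

text \<open>
  The random variable \<open>Y\<close> on \<open>N\<close> has the \<open>X\<close>-zero bias distribution, where \<open>X\<close> is a random
  variable on \<open>M\<close>; the two probability spaces may differ. An expectation exists if the integrand
  is integrable; this includes measurability, which is not required of the a.e. derivative
  \<open>f'\<close> itself. The notion is meant for \<open>X\<close> of mean zero with finite, non-zero variance.
\<close>

definition has_zero_bias_distribution ::
    "'a measure \<Rightarrow> ('a \<Rightarrow> real) \<Rightarrow> 'b measure \<Rightarrow> ('b \<Rightarrow> real) \<Rightarrow> bool" where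
  "has_zero_bias_distribution M X N Y \<longleftrightarrow>
     prob_space N \<and> Y \<in> borel_measurable N \<and>
     (\<forall>f f'. lipschitz_real f \<longrightarrow> ae_derivative f f' \<longrightarrow>
        integrable N (\<lambda>\<omega>. f' (Y \<omega>)) \<longrightarrow> integrable M (\<lambda>\<omega>. X \<omega> * f (X \<omega>)) \<longrightarrow>
        prob_space.variance M X * prob_space.expectation N (\<lambda>\<omega>. f' (Y \<omega>)) =
          prob_space.expectation M (\<lambda>\<omega>. X \<omega> * f (X \<omega>)))"

end

theory Submission
  imports Defs
begin

text \<open>
  Write \<open>\<sigma>\<^sup>2\<close> for the variance of \<open>X\<close>.  If \<open>g\<close> is Lipschitz with compact support and has a.e.
  derivative \<open>G\<close>, then for every fixed \<open>x\<close> the function \<open>h\<^sub>x(y) = (x - y) g(x + y)\<close> is again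
  Lipschitz, and the zero bias property of \<open>Y\<close>, applied to \<open>h\<^sub>x\<close>, reads
  \<open>\<sigma>\<^sup>2 E[(x - Y) G(x + Y) - g(x + Y)] = E[Z (x - Z) g(x + Z)]\<close>, where \<open>Z\<close> has the law of \<open>X\<close>.
  Multiplying by \<open>x\<close> and averaging over an independent \<open>x = X\<close> produces on the left \<open>\<sigma>\<^sup>2\<close> times
  the difference of the two sides of the claim for \<open>g\<close>.  On the right it produces the expectation
  of \<open>X Z (X - Z) g(X + Z)\<close> for independent copies \<open>X\<close> and \<open>Z\<close>; this changes sign when \<open>X\<close> and
  \<open>Z\<close> are exchanged, so it vanishes (lemma \<open>identity_for_compact_support\<close>).  Compact support
  matters here: with two moments only, \<open>X Z (X - Z) f(X + Z)\<close> and \<open>X Y\<close> may fail to be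
  integrable, but on \<open>\<bar>X + Z\<bar> \<le> c\<close> one has \<open>\<bar>X - Z\<bar> \<le> 2 \<bar>Z\<bar> + c\<close>, and the product
  \<open>\<bar>X\<bar> Z\<^sup>2\<close> is integrable by independence.

  A general \<open>f\<close> is multiplied by a cutoff \<open>\<phi>\<close> at scale \<open>c\<close>, and \<open>c \<rightarrow> \<infinity>\<close>.  The terms with
  \<open>f \<phi>\<close> and \<open>f' \<phi>\<close> converge by dominated convergence, directly from the assumed integrability.
  The remaining term \<open>X (X - Y) f(X + Y) \<phi>'(X + Y)\<close> tends to zero pointwise.  Since \<open>\<phi>'\<close> is
  bounded by \<open>4/c\<close> and lives on
  \<open>\<bar>X + Y\<bar> \<le> c\<close>, where \<open>\<bar>X - Y\<bar> \<le> 2 \<bar>X\<bar> + c\<close>, this term is at most a constant times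
  \<open>X\<^sup>2 + \<bar>X f(X + Y)\<bar>\<close>; so its expectation tends to zero by dominated convergence,
  even if \<open>Y\<close> has no first moment.

  The function \<open>f'\<close> may be non-measurable.  It is replaced by a bounded Borel function that agrees
  with it almost everywhere; this changes no expectation because the law of \<open>Y\<close>, hence that of
  \<open>X + Y\<close>, is absolutely continuous.
\<close>

section \<open>Lipschitz functions and their almost everywhere derivatives\<close>

lemma lipschitz_real_measurable:
  assumes "lipschitz_real f"
  shows "f \<in> borel_measurable borel"
  using assms lipschitz_on_continuous_on borel_measurable_continuous_onI
  unfolding lipschitz_real_def by blast

lemma lipschitz_realI:
  assumes "\<And>u v. \<bar>f u - f v\<bar> \<le> L * \<bar>u - v\<bar>"
  shows "lipschitz_real f"
proof -
  have "\<bar>f u - f v\<bar> \<le> max 0 L * \<bar>u - v\<bar>" for u v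
    by (rule order_trans[OF assms mult_right_mono]) auto
  hence "(max 0 L)-lipschitz_on UNIV f"
    by (intro lipschitz_onI) (auto simp: dist_real_def)
  thus ?thesis
    unfolding lipschitz_real_def by blast
qed

text \<open>
  The first factor may be unbounded: an increment of the product can be split so that the first
  factor is evaluated at whichever of the two points lies in the support of the second.
\<close>

lemma lipschitz_real_mult_compact_support:
  assumes a: "lipschitz_real a" and b: "lipschitz_real b"
    and supp: "\<And>u. c < \<bar>u\<bar> \<Longrightarrow> b u = 0" and "0 \<le> c"
  shows "lipschitz_real (\<lambda>u. a u * b u)"
    and "\<exists>B. \<forall>u. \<bar>b u\<bar> \<le> B"
proof -
  obtain La where La: "La-lipschitz_on UNIV a"
    using a unfolding lipschitz_real_def by blast
  obtain Lb where Lb: "Lb-lipschitz_on UNIV b"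
    using b unfolding lipschitz_real_def by blast
  note nn = lipschitz_on_nonneg[OF La] lipschitz_on_nonneg[OF Lb]
  have la: "\<bar>a u - a v\<bar> \<le> La * \<bar>u - v\<bar>" and lb: "\<bar>b u - b v\<bar> \<le> Lb * \<bar>u - v\<bar>" for u v
    using lipschitz_onD[OF La, of u v] lipschitz_onD[OF Lb, of u v]
    by (simp_all add: dist_real_def)
  define A where "A = \<bar>a 0\<bar> + La * c"
  define B where "B = \<bar>b 0\<bar> + Lb * c"
  have A: "\<bar>a u\<bar> \<le> A" if "\<bar>u\<bar> \<le> c" for u
    using la[of u 0] mult_left_mono[OF that nn(1)] unfolding A_def by simp
  have B: "\<bar>b u\<bar> \<le> B" for u
  proof (cases "\<bar>u\<bar> \<le> c")
    case True
    show ?thesis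
      using lb[of u 0] mult_left_mono[OF True nn(2)] unfolding B_def by simp
  next
    case False
    thus ?thesis
      using supp[of u] nn \<open>0 \<le> c\<close> unfolding B_def by simp
  qed
  thus "\<exists>B. \<forall>u. \<bar>b u\<bar> \<le> B"
    by blast
  have A0: "0 \<le> A"
    using nn \<open>0 \<le> c\<close> unfolding A_def by simp
  have near: "\<bar>a u * b u - a v * b v\<bar> \<le> (A * Lb + B * La) * \<bar>u - v\<bar>" if "\<bar>u\<bar> \<le> c" for u v
  proof -
    have "\<bar>a u * b u - a v * b v\<bar> = \<bar>a u * (b u - b v) + b v * (a u - a v)\<bar>"
      by (simp add: algebra_simps)
    also have "\<dots> \<le> \<bar>a u\<bar> * \<bar>b u - b v\<bar> + \<bar>b v\<bar> * \<bar>a u - a v\<bar>"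
      by (metis abs_mult abs_triangle_ineq)
    also have "\<dots> \<le> A * (Lb * \<bar>u - v\<bar>) + B * (La * \<bar>u - v\<bar>)"
      using A[OF that] B[of v] la[of u v] lb[of u v] A0 by (intro add_mono mult_mono) auto
    finally show ?thesis
      by (simp add: algebra_simps)
  qed
  show "lipschitz_real (\<lambda>u. a u * b u)"
  proof (rule lipschitz_realI)
    fix u v
    show "\<bar>a u * b u - a v * b v\<bar> \<le> (A * Lb + B * La) * \<bar>u - v\<bar>"
    proof (cases "\<bar>u\<bar> \<le> c \<or> \<bar>v\<bar> \<le> c")
      case True
      thus ?thesis
        using near[of u v] near[of v u] by (auto simp: abs_minus_commute)
    next
      case False
      have "0 \<le> B"
        using B[of 0] by simp
      with False show ?thesis
        using supp[of u] supp[of v] A0 nn by simp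
    qed
  qed
qed

lemma derivative_bound_of_lipschitz:
  assumes "L-lipschitz_on UNIV f" and d: "(f has_real_derivative d) (at x)"
  shows "\<bar>d\<bar> \<le> L"
proof -
  have "((\<lambda>y. \<bar>(f y - f x) / (y - x)\<bar>) \<longlongrightarrow> \<bar>d\<bar>) (at x)"
    using d unfolding has_field_derivative_iff by (rule tendsto_rabs)
  moreover have "\<bar>(f y - f x) / (y - x)\<bar> \<le> L" for y
    using lipschitz_onD[OF assms(1), of y x] lipschitz_on_nonneg[OF assms(1)]
    by (cases "y = x") (auto simp: dist_real_def field_simps)
  ultimately show ?thesis
    by (intro tendsto_upperbound[where F = "at x"]) auto
qed

text \<open>
  The difference quotients along \<open>1/(n + 1)\<close> converge to the derivative wherever it exists;
  clamping their limit to \<open>[-L, L]\<close> keeps the value there and bounds it everywhere else.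
\<close>

lemma bounded_borel_derivative:
  assumes f: "L-lipschitz_on UNIV f" and f': "ae_derivative f f'"
  obtains D where "D \<in> borel_measurable borel" "\<And>x. \<bar>D x\<bar> \<le> L"
    "AE x in lborel. D x = f' x" "ae_derivative f D"
proof -
  note nn = lipschitz_on_nonneg[OF f]
  have [measurable]: "f \<in> borel_measurable borel"
    using f lipschitz_real_measurable unfolding lipschitz_real_def by blast
  define q where "q n x = (f (x + inverse (real (Suc n))) - f x) / inverse (real (Suc n))" for n x
  define D where "D x = max (- L) (min L (lim (\<lambda>n. q n x)))" for x
  have [measurable]: "q n \<in> borel_measurable borel" for n
    unfolding q_def by measurable
  have meas: "D \<in> borel_measurable borel"
    unfolding D_def by measurable
  have eq: "D x = d" if d: "(f has_real_derivative d) (at x)" for x d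
  proof -
    have "(\<lambda>n. q n x) \<longlonglongrightarrow> d"
    proof -
      have "((\<lambda>h. (f (x + h) - f x) / h) \<longlongrightarrow> d) (at 0)"
        using d by (simp add: DERIV_def)
      moreover have "filterlim (\<lambda>n. inverse (real (Suc n))) (at 0) sequentially"
        by (rule filterlim_atI[OF LIMSEQ_inverse_real_of_nat]) simp
      ultimately show ?thesis
        unfolding q_def by (rule filterlim_compose)
    qed
    hence "lim (\<lambda>n. q n x) = d"
      by (rule limI)
    thus ?thesis
      using derivative_bound_of_lipschitz[OF f d] unfolding D_def by auto
  qed
  show ?thesis
  proof (rule that[OF meas])
    show "\<bar>D x\<bar> \<le> L" for x
      using nn unfolding D_def by auto
    show "AE x in lborel. D x = f' x"
      using f' unfolding ae_derivative_def by (rule eventually_mono) (rule eq)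
    show "ae_derivative f D"
      using f' unfolding ae_derivative_def by (rule eventually_mono) (use eq in metis)
  qed
qed

lemma AE_lborel_translate:
  fixes Q :: "real \<Rightarrow> bool"
  assumes "AE x in lborel. Q x"
  shows "AE y in lborel. Q (x + y)"
proof -
  obtain N where N: "\<And>u. u \<in> space lborel - N \<Longrightarrow> Q u" "N \<in> null_sets lborel"
    using AE_E3[OF assms] by blast
  have [measurable]: "N \<in> sets borel"
    using N(2) by auto
  have "AE y in lborel. x + 1 * y \<notin> N"
    by (rule AE_borel_affine) (use N(2) in \<open>auto intro: AE_not_in\<close>)
  thus ?thesis
    by (rule eventually_mono) (use N(1) in auto)
qed

section \<open>A differentiable cutoff function\<close>

text \<open>Squaring the positive part makes the truncated parabola differentiable at \<open>\<plusminus>c\<close> as well.\<close>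

definition cutoff :: "real \<Rightarrow> real \<Rightarrow> real" where
  "cutoff c u = (max 0 (1 - (u / c)\<^sup>2))\<^sup>2"

definition cutoff_deriv :: "real \<Rightarrow> real \<Rightarrow> real" where
  "cutoff_deriv c u = - (4 * u / c\<^sup>2) * max 0 (1 - (u / c)\<^sup>2)"

lemma positive_part_square_derivative:
  "((\<lambda>t::real. (max 0 t)\<^sup>2) has_real_derivative 2 * max 0 t) (at t)"
proof (cases "t = 0")
  case True
  have "((\<lambda>h::real. (max 0 h)\<^sup>2 / h) \<longlongrightarrow> 0) (at 0)"
  proof (rule Lim_null_comparison)
    show "\<forall>\<^sub>F h::real in at 0. norm ((max 0 h)\<^sup>2 / h) \<le> \<bar>h\<bar>"
      by (rule always_eventually) (auto simp: max_def power2_eq_square)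
    show "((\<lambda>h::real. \<bar>h\<bar>) \<longlongrightarrow> 0) (at 0)"
      by (rule tendsto_eq_intros refl | simp)+
  qed
  thus ?thesis
    using True by (simp add: DERIV_def)
next
  case False
  show ?thesis
  proof (cases "0 < t")
    case True
    have "((\<lambda>t::real. t\<^sup>2) has_real_derivative 2 * t) (at t)"
      by (auto intro!: derivative_eq_intros)
    moreover have "\<forall>\<^sub>F s in nhds t. (max 0 s)\<^sup>2 = s\<^sup>2"
      using eventually_nhds_in_open[OF open_greaterThan, of t 0] True
      by (auto elim!: eventually_mono)
    ultimately show ?thesis
      using True by (subst DERIV_cong_ev[OF refl _ refl]) (auto simp: max_def)
  next
    case neg: False
    have "\<forall>\<^sub>F s in nhds t. (max 0 s)\<^sup>2 = 0"
      using eventually_nhds_in_open[OF open_lessThan, of t 0] neg \<open>t \<noteq> 0\<close>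
      by (auto elim!: eventually_mono)
    hence "((\<lambda>s. (max 0 s)\<^sup>2) has_real_derivative 0) (at t)"
      by (subst DERIV_cong_ev[where g = "\<lambda>_. 0", OF refl _ refl]) auto
    thus ?thesis
      using neg by simp
  qed
qed

lemma cutoff_has_derivative:
  assumes "0 < c"
  shows "(cutoff c has_real_derivative cutoff_deriv c u) (at u)"
proof -
  have "((\<lambda>u. 1 - (u / c)\<^sup>2) has_real_derivative - (2 * u / c\<^sup>2)) (at u)"
    using assms by (auto intro!: derivative_eq_intros simp: power2_eq_square)
  from DERIV_chain2[OF positive_part_square_derivative this] show ?thesis
    unfolding cutoff_def[abs_def] cutoff_deriv_def by (simp add: algebra_simps)
qed

lemma cutoff_measurable [measurable]:
  "cutoff c \<in> borel_measurable borel" "cutoff_deriv c \<in> borel_measurable borel"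
  unfolding cutoff_def[abs_def] cutoff_deriv_def[abs_def] by measurable

lemma cutoff_outside:
  assumes "0 < c" "c < \<bar>u\<bar>"
  shows "cutoff c u = 0" "cutoff_deriv c u = 0"
proof -
  have "1 \<le> \<bar>u / c\<bar>"
    using assms by (simp add: field_simps)
  hence "1 \<le> (u / c)\<^sup>2"
    by (metis one_le_power power2_abs)
  thus "cutoff c u = 0" "cutoff_deriv c u = 0"
    unfolding cutoff_def cutoff_deriv_def by auto
qed

lemma cutoff_bounds: "0 \<le> cutoff c u" "cutoff c u \<le> 1"
  unfolding cutoff_def by (auto intro!: power_le_one)

lemma cutoff_deriv_bound_pointwise:
  "\<bar>cutoff_deriv c u\<bar> \<le> 4 * \<bar>u\<bar> / c\<^sup>2"
proof -
  have "\<bar>cutoff_deriv c u\<bar> = 4 * \<bar>u\<bar> / c\<^sup>2 * max 0 (1 - (u / c)\<^sup>2)"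
    unfolding cutoff_deriv_def by (simp add: abs_mult)
  also have "\<dots> \<le> 4 * \<bar>u\<bar> / c\<^sup>2 * 1"
    by (intro mult_left_mono) auto
  finally show ?thesis
    by simp
qed

lemma cutoff_deriv_bound:
  assumes "0 < c"
  shows "\<bar>cutoff_deriv c u\<bar> \<le> 4 / c"
proof (cases "\<bar>u\<bar> \<le> c")
  case True
  have "4 * \<bar>u\<bar> / c\<^sup>2 \<le> 4 * c / c\<^sup>2"
    using True by (intro divide_right_mono) auto
  also have "\<dots> = 4 / c"
    using assms by (simp add: power2_eq_square)
  finally show ?thesis
    using cutoff_deriv_bound_pointwise[of c u] by linarith
next
  case False
  thus ?thesis
    using cutoff_outside(2)[of c u] assms by auto
qed

lemma cutoff_lipschitz:
  assumes "0 < c"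
  shows "lipschitz_real (cutoff c)"
proof (rule lipschitz_realI)
  fix u v
  have "norm (cutoff c u - cutoff c v) \<le> 4 / c * norm (u - v)"
    by (rule field_differentiable_bound[where S = UNIV and f' = "cutoff_deriv c"])
      (use assms cutoff_has_derivative cutoff_deriv_bound in auto)
  thus "\<bar>cutoff c u - cutoff c v\<bar> \<le> 4 / c * \<bar>u - v\<bar>"
    by simp
qed

lemma cutoff_tendsto:
  "(\<lambda>n. cutoff (real (Suc n)) u) \<longlonglongrightarrow> 1" "(\<lambda>n. cutoff_deriv (real (Suc n)) u) \<longlonglongrightarrow> 0"
proof -
  have 1: "(\<lambda>n. u / real (Suc n)) \<longlonglongrightarrow> 0"
    using tendsto_mult_right[OF LIMSEQ_inverse_real_of_nat, of u]
    by (simp add: divide_inverse mult.commute)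
  hence "(\<lambda>n. (max 0 (1 - (u / real (Suc n))\<^sup>2))\<^sup>2) \<longlonglongrightarrow> (max 0 (1 - 0\<^sup>2))\<^sup>2"
    by (intro tendsto_intros)
  thus "(\<lambda>n. cutoff (real (Suc n)) u) \<longlonglongrightarrow> 1"
    unfolding cutoff_def by simp
  have "(\<lambda>n. 4 / real (Suc n)) \<longlonglongrightarrow> 0"
    using tendsto_mult_right[OF LIMSEQ_inverse_real_of_nat, of 4]
    by (simp add: divide_inverse mult.commute)
  thus "(\<lambda>n. cutoff_deriv (real (Suc n)) u) \<longlonglongrightarrow> 0"
    by (rule Lim_null_comparison[rotated])
      (auto intro!: always_eventually cutoff_deriv_bound simp del: of_nat_Suc)
qed

section \<open>Independent summands, one with the zero bias distribution of the other\<close>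

locale independent_zero_bias = prob_space M
  for M :: "'a measure" +
  fixes X Y :: "'a \<Rightarrow> real"
  assumes X_integrable: "integrable M X"
    and X_square_integrable: "integrable M (\<lambda>\<omega>. (X \<omega>)\<^sup>2)"
    and X_variance: "variance X \<noteq> 0"
    and indep: "indep_var borel X borel Y"
    and zero_bias: "has_zero_bias_distribution M X M Y"
begin

lemma X_measurable [measurable]: "X \<in> borel_measurable M"
  using X_integrable by auto

lemma Y_measurable [measurable]: "Y \<in> borel_measurable M"
  using zero_bias unfolding has_zero_bias_distribution_def by auto

abbreviation law_X :: "real measure" where "law_X \<equiv> distr M borel X"

abbreviation law_Y :: "real measure" where "law_Y \<equiv> distr M borel Y"

sublocale law_X: prob_space law_X
  by (rule prob_space_distr) measurable

sublocale law_Y: prob_space law_Y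
  by (rule prob_space_distr) measurable

sublocale XY: pair_prob_space law_X law_Y ..

sublocale XX: pair_prob_space law_X law_X ..

lemma joint_law: "law_X \<Otimes>\<^sub>M law_Y = distr M (borel \<Otimes>\<^sub>M borel) (\<lambda>\<omega>. (X \<omega>, Y \<omega>))"
  using indep unfolding indep_var_distribution_eq by simp

text \<open>
  The zero function has the indicator of a null set as an a.e. derivative, so the zero bias
  property gives null sets mass zero.
\<close>

lemma law_Y_absolutely_continuous:
  assumes "AE y in lborel. Q y"
  shows "AE y in law_Y. Q y"
proof -
  obtain N where N: "\<And>y. y \<in> space lborel - N \<Longrightarrow> Q y" "N \<in> null_sets lborel"
    using AE_E3[OF assms] by blast
  have Nb [measurable]: "N \<in> sets borel"
    using N(2) by auto
  have "lipschitz_real (\<lambda>_. 0)"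
    by (rule lipschitz_realI[of _ 0]) simp
  moreover have "ae_derivative (\<lambda>_. 0) (indicator N)"
    using AE_not_in[OF N(2)] unfolding ae_derivative_def by (rule eventually_mono) auto
  moreover have int: "integrable M (\<lambda>\<omega>. indicator N (Y \<omega>) :: real)"
    by (rule integrable_const_bound[where B = 1]) (auto simp: indicator_def)
  ultimately have "variance X * expectation (\<lambda>\<omega>. indicator N (Y \<omega>) :: real) = 0"
    using zero_bias unfolding has_zero_bias_distribution_def by fastforce
  hence "expectation (\<lambda>\<omega>. indicator N (Y \<omega>) :: real) = 0"
    using X_variance by simp
  hence "AE \<omega> in M. (indicator N (Y \<omega>) :: real) = 0"
    by (subst (asm) integral_nonneg_eq_0_iff_AE[OF int]) auto
  hence "AE \<omega> in M. Y \<omega> \<notin> N"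
    by (rule eventually_mono) (auto simp: indicator_def split: if_splits)
  hence "AE y in law_Y. y \<notin> N"
    by (subst AE_distr_iff) auto
  thus ?thesis
    by (rule eventually_mono) (use N(1) in auto)
qed

lemma sum_absolutely_continuous:
  assumes "AE u in lborel. Q u"
  shows "AE \<omega> in M. Q (X \<omega> + Y \<omega>)"
proof -
  obtain N where N: "\<And>y. y \<in> space lborel - N \<Longrightarrow> Q y" "N \<in> null_sets lborel"
    using AE_E3[OF assms] by blast
  have Nb [measurable]: "N \<in> sets borel"
    using N(2) by auto
  have slices: "AE x in law_X. AE y in law_Y. x + y \<notin> N"
    by (intro AE_I2 law_Y_absolutely_continuous AE_lborel_translate AE_not_in N(2))
  have "AE p in law_X \<Otimes>\<^sub>M law_Y. fst p + snd p \<notin> N"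
  proof (rule XY.AE_pair_measure)
    show "{p \<in> space (law_X \<Otimes>\<^sub>M law_Y). fst p + snd p \<notin> N} \<in> sets (law_X \<Otimes>\<^sub>M law_Y)"
      by measurable
  qed (use slices in simp)
  hence "AE \<omega> in M. X \<omega> + Y \<omega> \<notin> N"
    unfolding joint_law by (subst (asm) AE_distr_iff) auto
  thus ?thesis
    by (rule eventually_mono) (use N(1) in auto)
qed

lemma zero_bias_laws:
  assumes h: "lipschitz_real h" "ae_derivative h h'" and [measurable]: "h' \<in> borel_measurable borel"
    and int: "integrable law_Y h'" "integrable law_X (\<lambda>z. z * h z)"
  shows "variance X * (\<integral>y. h' y \<partial>law_Y) = (\<integral>z. z * h z \<partial>law_X)"
proof -
  have [measurable]: "h \<in> borel_measurable borel"
    using h(1) by (rule lipschitz_real_measurable)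
  have "integrable M (\<lambda>\<omega>. h' (Y \<omega>))" "integrable M (\<lambda>\<omega>. X \<omega> * h (X \<omega>))"
    using int by (simp_all add: integrable_distr_eq)
  hence "variance X * expectation (\<lambda>\<omega>. h' (Y \<omega>)) = expectation (\<lambda>\<omega>. X \<omega> * h (X \<omega>))"
    using zero_bias h unfolding has_zero_bias_distribution_def by blast
  thus ?thesis
    by (simp add: integral_distr)
qed

text \<open>
  The integrand is antisymmetric; the content of the lemma is that compact support makes it
  integrable when \<open>X\<close> has only two moments.
\<close>

lemma antisymmetric_integral_eq_0:
  assumes [measurable]: "g \<in> borel_measurable borel"
    and B: "\<And>u. \<bar>g u\<bar> \<le> B" and supp: "\<And>u. c < \<bar>u\<bar> \<Longrightarrow> g u = 0" and "0 \<le> c"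
  shows "(\<integral>x. (\<integral>z. x * (z * ((x - z) * g (x + z))) \<partial>law_X) \<partial>law_X) = 0"
proof -
  define k where "k p = fst p * (snd p * ((fst p - snd p) * g (fst p + snd p)))" for p :: "real \<times> real"
  define w where "w z = B * (2 * z\<^sup>2 + c * \<bar>z\<bar>)" for z :: real
  have k_meas [measurable]: "k \<in> borel_measurable (law_X \<Otimes>\<^sub>M law_X)"
    unfolding k_def by measurable
  have B0: "0 \<le> B"
    using B[of 0] by linarith
  have iX: "integrable law_X (\<lambda>x. \<bar>x\<bar>)"
    using X_integrable by (simp add: integrable_distr_eq)
  have iw: "integrable law_X w"
    unfolding w_def using X_integrable X_square_integrable by (simp add: integrable_distr_eq)
  have "integrable (law_X \<Otimes>\<^sub>M law_X) (\<lambda>(x, z). \<bar>x\<bar> * w z)"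
  proof (rule XX.Fubini_integrable)
    show "(\<lambda>(x, z). \<bar>x\<bar> * w z) \<in> borel_measurable (law_X \<Otimes>\<^sub>M law_X)"
      unfolding w_def by measurable
    show "AE x in law_X. integrable law_X (\<lambda>z. case (x, z) of (x, z) \<Rightarrow> \<bar>x\<bar> * w z)"
      using iw by simp
    show "integrable law_X (\<lambda>x. \<integral>z. norm (case (x, z) of (x, z) \<Rightarrow> \<bar>x\<bar> * w z) \<partial>law_X)"
      using iX by (simp add: abs_mult)
  qed
  hence int: "integrable (law_X \<Otimes>\<^sub>M law_X) k"
  proof (rule Bochner_Integration.integrable_bound[OF _ k_meas], intro AE_I2)
    fix p :: "real \<times> real"
    obtain x z where p: "p = (x, z)"
      by force
    have "\<bar>(x - z) * g (x + z)\<bar> \<le> (2 * \<bar>z\<bar> + c) * B"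
    proof (cases "\<bar>x + z\<bar> \<le> c")
      case True
      thus ?thesis
        unfolding abs_mult using B[of "x + z"] by (intro mult_mono) auto
    next
      case False
      thus ?thesis
        using supp[of "x + z"] B0 \<open>0 \<le> c\<close> by simp
    qed
    hence "\<bar>x\<bar> * (\<bar>z\<bar> * \<bar>(x - z) * g (x + z)\<bar>) \<le> \<bar>x\<bar> * (\<bar>z\<bar> * ((2 * \<bar>z\<bar> + c) * B))"
      by (intro mult_left_mono) auto
    also have "\<dots> = \<bar>x\<bar> * w z"
      unfolding w_def by (simp add: algebra_simps power2_eq_square)
    finally have "norm (k p) \<le> \<bar>x\<bar> * w z"
      unfolding k_def p by (simp add: abs_mult)
    thus "norm (k p) \<le> norm (case p of (x, z) \<Rightarrow> \<bar>x\<bar> * w z)"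
      unfolding p by simp
  qed
  have "(\<integral>p. k p \<partial>(law_X \<Otimes>\<^sub>M law_X)) = (\<integral>(x, z). k (z, x) \<partial>(law_X \<Otimes>\<^sub>M law_X))"
    by (rule XX.integral_product_swap[symmetric]) measurable
  also have "\<dots> = (\<integral>p. - k p \<partial>(law_X \<Otimes>\<^sub>M law_X))"
    by (rule Bochner_Integration.integral_cong) (auto simp: k_def algebra_simps)
  finally have "(\<integral>p. k p \<partial>(law_X \<Otimes>\<^sub>M law_X)) = 0"
    by simp
  thus ?thesis
    using XX.integral_fst'[OF int] unfolding k_def by simp
qed

text \<open>
  The zero bias property is used once for every value \<open>x\<close> of \<open>X\<close>, with the test function
  \<open>y \<mapsto> (x - y) g(x + y)\<close>.  The factor \<open>x - y\<close> is chosen so that, after multiplication by \<open>x\<close>, the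
  term \<open>x z (x - z) g(x + z)\<close> that arises is antisymmetric, while the derivative reproduces both
  \<open>g\<close> and the factor \<open>X\<^sup>2 - X Y\<close>.
\<close>

lemma identity_for_compact_support:
  assumes g: "lipschitz_real g" and gG: "ae_derivative g G"
    and G_meas [measurable]: "G \<in> borel_measurable borel" and K: "\<And>u. \<bar>G u\<bar> \<le> K"
    and g_supp: "\<And>u. c < \<bar>u\<bar> \<Longrightarrow> g u = 0" and G_supp: "\<And>u. c < \<bar>u\<bar> \<Longrightarrow> G u = 0"
    and "0 \<le> c"
  shows "expectation (\<lambda>\<omega>. X \<omega> * g (X \<omega> + Y \<omega>)) =
    expectation (\<lambda>\<omega>. X \<omega> * (X \<omega> - Y \<omega>) * G (X \<omega> + Y \<omega>))"
proof -
  have g_meas [measurable]: "g \<in> borel_measurable borel"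
    using g by (rule lipschitz_real_measurable)
  obtain B where B: "\<And>u. \<bar>g u\<bar> \<le> B"
    using lipschitz_real_mult_compact_support(2)[OF g g g_supp \<open>0 \<le> c\<close>] by blast
  have B0: "0 \<le> B" and K0: "0 \<le> K"
    using B[of 0] K[of 0] by linarith+
  define h' where "h' x y = (x - y) * G (x + y) - g (x + y)" for x y
  have h'_bound: "\<bar>(x - y) * G (x + y)\<bar> \<le> (2 * \<bar>x\<bar> + c) * K" for x y
  proof (cases "\<bar>x + y\<bar> \<le> c")
    case True
    thus ?thesis
      unfolding abs_mult using K[of "x + y"] by (intro mult_mono) auto
  next
    case False
    thus ?thesis
      using G_supp[of "x + y"] K0 \<open>0 \<le> c\<close> by simp
  qed
  have slice: "variance X * (\<integral>y. h' x y \<partial>law_Y) = (\<integral>z. z * ((x - z) * g (x + z)) \<partial>law_X)" for x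
  proof (rule zero_bias_laws)
    \<comment> \<open>in the variable \<open>u = x + y\<close> the function \<open>(x - y) g(x + y)\<close> is \<open>(2 x - u) g(u)\<close>\<close>
    have "lipschitz_real (\<lambda>u. 2 * x - u)"
      by (rule lipschitz_realI[of _ 1]) auto
    note lin = lipschitz_real_mult_compact_support[OF this g g_supp \<open>0 \<le> c\<close>]
    then obtain L where L: "L-lipschitz_on UNIV (\<lambda>u. (2 * x - u) * g u)"
      unfolding lipschitz_real_def by blast
    show h_lip: "lipschitz_real (\<lambda>y. (x - y) * g (x + y))"
    proof (rule lipschitz_realI)
      fix u v
      show "\<bar>(x - u) * g (x + u) - (x - v) * g (x + v)\<bar> \<le> L * \<bar>u - v\<bar>"
        using lipschitz_onD[OF L, of "x + u" "x + v"] by (simp add: dist_real_def)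
    qed
    have "AE y in lborel. (g has_real_derivative G (x + y)) (at (x + y))"
      using gG unfolding ae_derivative_def by (rule AE_lborel_translate)
    thus "ae_derivative (\<lambda>y. (x - y) * g (x + y)) (h' x)"
      unfolding ae_derivative_def
    proof (rule eventually_mono)
      fix y
      assume "(g has_real_derivative G (x + y)) (at (x + y))"
      hence "((\<lambda>y. g (x + y)) has_real_derivative G (x + y)) (at y)"
        using DERIV_shift[of g "G (x + y)" y x] by (simp add: add.commute)
      thus "((\<lambda>y. (x - y) * g (x + y)) has_real_derivative h' x y) (at y)"
        unfolding h'_def by (auto intro!: derivative_eq_intros)
    qed
    show h'_meas: "h' x \<in> borel_measurable borel"
      unfolding h'_def by measurable
    show "integrable law_Y (h' x)"
    proof (rule law_Y.integrable_const_bound[where B = "(2 * \<bar>x\<bar> + c) * K + B"])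
      show "AE y in law_Y. norm (h' x y) \<le> (2 * \<bar>x\<bar> + c) * K + B"
      proof (rule AE_I2)
        fix y
        show "norm (h' x y) \<le> (2 * \<bar>x\<bar> + c) * K + B"
          using h'_bound[of x y] B[of "x + y"] unfolding h'_def by (simp add: abs_le_iff)
      qed
      show "h' x \<in> borel_measurable law_Y"
        using h'_meas by simp
    qed
    have "\<bar>(x - z) * g (x + z)\<bar> \<le> (2 * \<bar>x\<bar> + c) * B" for z
    proof (cases "\<bar>x + z\<bar> \<le> c")
      case True
      thus ?thesis
        unfolding abs_mult using B[of "x + z"] by (intro mult_mono) auto
    next
      case False
      thus ?thesis
        using g_supp[of "x + z"] B0 \<open>0 \<le> c\<close> by simp
    qed
    hence bd: "\<bar>z * ((x - z) * g (x + z))\<bar> \<le> \<bar>z\<bar> * ((2 * \<bar>x\<bar> + c) * B)" for z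
      unfolding abs_mult[of z] by (rule mult_left_mono) auto
    have "integrable law_X (\<lambda>z. \<bar>z\<bar> * ((2 * \<bar>x\<bar> + c) * B))"
      using X_integrable by (simp add: integrable_distr_eq)
    thus "integrable law_X (\<lambda>z. z * ((x - z) * g (x + z)))"
      by (rule Bochner_Integration.integrable_bound)
        (auto intro!: AE_I2 order_trans[OF bd])
  qed
  have int_g: "integrable M (\<lambda>\<omega>. X \<omega> * g (X \<omega> + Y \<omega>))"
  proof (rule Bochner_Integration.integrable_bound)
    show "integrable M (\<lambda>\<omega>. \<bar>X \<omega>\<bar> * B)"
      using X_integrable by simp
    show "AE \<omega> in M. norm (X \<omega> * g (X \<omega> + Y \<omega>)) \<le> norm (\<bar>X \<omega>\<bar> * B)"
      using B B0 by (auto simp: abs_mult intro!: AE_I2 mult_left_mono)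
  qed measurable
  have int_G: "integrable M (\<lambda>\<omega>. X \<omega> * (X \<omega> - Y \<omega>) * G (X \<omega> + Y \<omega>))"
  proof (rule Bochner_Integration.integrable_bound)
    show "integrable M (\<lambda>\<omega>. (2 * (X \<omega>)\<^sup>2 + c * \<bar>X \<omega>\<bar>) * K)"
      using X_integrable X_square_integrable by simp
    show "AE \<omega> in M. norm (X \<omega> * (X \<omega> - Y \<omega>) * G (X \<omega> + Y \<omega>)) \<le> norm ((2 * (X \<omega>)\<^sup>2 + c * \<bar>X \<omega>\<bar>) * K)"
    proof (rule AE_I2)
      fix \<omega>
      have "\<bar>X \<omega>\<bar> * \<bar>(X \<omega> - Y \<omega>) * G (X \<omega> + Y \<omega>)\<bar> \<le> \<bar>X \<omega>\<bar> * ((2 * \<bar>X \<omega>\<bar> + c) * K)"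
        by (rule mult_left_mono[OF h'_bound]) simp
      also have "\<dots> = (2 * (X \<omega>)\<^sup>2 + c * \<bar>X \<omega>\<bar>) * K"
        by (simp add: algebra_simps power2_eq_square)
      finally show "norm (X \<omega> * (X \<omega> - Y \<omega>) * G (X \<omega> + Y \<omega>)) \<le> norm ((2 * (X \<omega>)\<^sup>2 + c * \<bar>X \<omega>\<bar>) * K)"
        using K0 \<open>0 \<le> c\<close> by (simp add: abs_mult mult.assoc)
    qed
  qed measurable
  have int_diff: "integrable M (\<lambda>\<omega>. X \<omega> * h' (X \<omega>) (Y \<omega>))"
    using Bochner_Integration.integrable_diff[OF int_G int_g]
    unfolding h'_def by (simp add: algebra_simps)
  have k_meas [measurable]: "(\<lambda>p. fst p * h' (fst p) (snd p)) \<in> borel_measurable (borel \<Otimes>\<^sub>M borel)"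
    unfolding h'_def by measurable
  have int_k: "integrable (law_X \<Otimes>\<^sub>M law_Y) (\<lambda>p. fst p * h' (fst p) (snd p))"
    unfolding joint_law using int_diff by (subst integrable_distr_eq) auto
  have "expectation (\<lambda>\<omega>. X \<omega> * h' (X \<omega>) (Y \<omega>)) =
      (\<integral>p. fst p * h' (fst p) (snd p) \<partial>(law_X \<Otimes>\<^sub>M law_Y))"
    unfolding joint_law by (subst integral_distr) auto
  also have "\<dots> = (\<integral>x. (\<integral>y. x * h' x y \<partial>law_Y) \<partial>law_X)"
    using XY.integral_fst'[OF int_k] by simp
  finally have "variance X * expectation (\<lambda>\<omega>. X \<omega> * h' (X \<omega>) (Y \<omega>)) =
      (\<integral>x. x * (variance X * (\<integral>y. h' x y \<partial>law_Y)) \<partial>law_X)"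
    by (simp add: mult.left_commute[of _ "variance X"])
  also have "\<dots> = (\<integral>x. (\<integral>z. x * (z * ((x - z) * g (x + z))) \<partial>law_X) \<partial>law_X)"
    unfolding slice by simp
  also have "\<dots> = 0"
    by (rule antisymmetric_integral_eq_0[OF g_meas B g_supp \<open>0 \<le> c\<close>])
  finally have "expectation (\<lambda>\<omega>. X \<omega> * h' (X \<omega>) (Y \<omega>)) = 0"
    using X_variance by simp
  moreover have "expectation (\<lambda>\<omega>. X \<omega> * h' (X \<omega>) (Y \<omega>)) =
      expectation (\<lambda>\<omega>. X \<omega> * (X \<omega> - Y \<omega>) * G (X \<omega> + Y \<omega>) - X \<omega> * g (X \<omega> + Y \<omega>))"
    unfolding h'_def by (simp add: algebra_simps)
  ultimately show ?thesis
    using Bochner_Integration.integral_diff[OF int_G int_g] by simp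
qed

section \<open>Removing the cutoff\<close>

lemma truncated_identity:
  assumes f: "L-lipschitz_on UNIV f" and fD: "ae_derivative f D"
    and D_meas [measurable]: "D \<in> borel_measurable borel" and D: "\<And>u. \<bar>D u\<bar> \<le> L"
    and c: "0 < c"
  shows "expectation (\<lambda>\<omega>. X \<omega> * (f (X \<omega> + Y \<omega>) * cutoff c (X \<omega> + Y \<omega>))) =
    expectation (\<lambda>\<omega>. X \<omega> * (X \<omega> - Y \<omega>) *
      (D (X \<omega> + Y \<omega>) * cutoff c (X \<omega> + Y \<omega>) + f (X \<omega> + Y \<omega>) * cutoff_deriv c (X \<omega> + Y \<omega>)))"
proof (rule identity_for_compact_support)
  have f_lip: "lipschitz_real f"
    using f unfolding lipschitz_real_def by blast
  have f_meas [measurable]: "f \<in> borel_measurable borel"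
    using f_lip by (rule lipschitz_real_measurable)
  note L0 = lipschitz_on_nonneg[OF f]
  show "lipschitz_real (\<lambda>u. f u * cutoff c u)"
    by (rule lipschitz_real_mult_compact_support[OF f_lip cutoff_lipschitz[OF c]
          cutoff_outside(1)[OF c] less_imp_le[OF c]])
  show "ae_derivative (\<lambda>u. f u * cutoff c u) (\<lambda>u. D u * cutoff c u + f u * cutoff_deriv c u)"
    unfolding ae_derivative_def using fD[unfolded ae_derivative_def]
  proof (rule eventually_mono)
    fix u
    assume "(f has_real_derivative D u) (at u)"
    from DERIV_mult[OF this cutoff_has_derivative[OF c]]
    show "((\<lambda>u. f u * cutoff c u) has_real_derivative D u * cutoff c u + f u * cutoff_deriv c u) (at u)"
      by (simp add: algebra_simps)
  qed
  show "(\<lambda>u. D u * cutoff c u + f u * cutoff_deriv c u) \<in> borel_measurable borel"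
    by measurable
  show "\<bar>D u * cutoff c u + f u * cutoff_deriv c u\<bar> \<le> L + (\<bar>f 0\<bar> + L * c) * (4 / c)" for u
  proof (cases "\<bar>u\<bar> \<le> c")
    case True
    have "\<bar>f u\<bar> \<le> \<bar>f 0\<bar> + L * c"
      using lipschitz_onD[OF f, of u 0] mult_left_mono[OF True L0] by (simp add: dist_real_def)
    hence "\<bar>f u * cutoff_deriv c u\<bar> \<le> (\<bar>f 0\<bar> + L * c) * (4 / c)"
      unfolding abs_mult using cutoff_deriv_bound[OF c, of u] by (intro mult_mono) auto
    moreover have "\<bar>D u * cutoff c u\<bar> \<le> L * 1"
      unfolding abs_mult using D[of u] L0 cutoff_bounds[of c u] by (intro mult_mono) auto
    ultimately show ?thesis
      by linarith
  next
    case False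
    thus ?thesis
      using cutoff_outside[OF c, of u] L0 c by simp
  qed
qed (use c cutoff_outside[OF c] in auto)

text \<open>
  On the support of the cutoff \<open>\<bar>x - y\<bar> \<le> 2 \<bar>x\<bar> + c\<close>, while the derivative of the cutoff is at most
  \<open>4/c\<close>.  Against \<open>2 \<bar>x\<bar>\<close> the factor \<open>1/c\<close> absorbs the linear growth of \<open>f\<close>; against \<open>c\<close> it
  cancels and leaves \<open>\<bar>x f(x + y)\<bar>\<close>, which is integrable by assumption in the application.  The
  bound is uniform in \<open>c\<close>.
\<close>

lemma cutoff_error_bound:
  assumes f: "L-lipschitz_on UNIV f" and c: "1 \<le> c"
  shows "\<bar>x * (x - y) * (f (x + y) * cutoff_deriv c (x + y))\<bar> \<le>
    8 * (\<bar>f 0\<bar> + L) * x\<^sup>2 + 4 * \<bar>x * f (x + y)\<bar>"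
proof (cases "\<bar>x + y\<bar> \<le> c")
  case True
  note L0 = lipschitz_on_nonneg[OF f]
  have "\<bar>f (x + y)\<bar> \<le> \<bar>f 0\<bar> + L * c"
    using lipschitz_onD[OF f, of "x + y" 0] mult_left_mono[OF True L0] by (simp add: dist_real_def)
  also have "\<dots> \<le> (\<bar>f 0\<bar> + L) * c"
    using mult_left_mono[OF c abs_ge_zero[of "f 0"]] by (simp add: algebra_simps)
  finally have fc: "\<bar>f (x + y)\<bar> / c \<le> \<bar>f 0\<bar> + L"
    using c by (simp add: field_simps)
  have "\<bar>x * (x - y) * (f (x + y) * cutoff_deriv c (x + y))\<bar> =
      \<bar>x\<bar> * \<bar>x - y\<bar> * (\<bar>f (x + y)\<bar> * \<bar>cutoff_deriv c (x + y)\<bar>)"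
    by (simp add: abs_mult)
  also have "\<dots> \<le> \<bar>x\<bar> * (2 * \<bar>x\<bar> + c) * (\<bar>f (x + y)\<bar> * (4 / c))"
    using True c cutoff_deriv_bound[of c "x + y"] by (intro mult_mono) auto
  also have "\<dots> = 8 * x\<^sup>2 * (\<bar>f (x + y)\<bar> / c) + 4 * \<bar>x * f (x + y)\<bar>"
    using c by (simp add: field_simps power2_eq_square abs_mult)
  also have "\<dots> \<le> 8 * x\<^sup>2 * (\<bar>f 0\<bar> + L) + 4 * \<bar>x * f (x + y)\<bar>"
    using fc by (intro add_mono mult_left_mono) auto
  finally show ?thesis
    by (simp only: mult_ac)
next
  case False
  thus ?thesis
    using cutoff_outside(2)[of c "x + y"] c lipschitz_on_nonneg[OF f] by simp
qed

lemma identity_for_borel_derivative: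
  assumes f: "L-lipschitz_on UNIV f" and fD: "ae_derivative f D"
    and D_meas [measurable]: "D \<in> borel_measurable borel" and D: "\<And>u. \<bar>D u\<bar> \<le> L"
    and int_f: "integrable M (\<lambda>\<omega>. X \<omega> * f (X \<omega> + Y \<omega>))"
    and int_D: "integrable M (\<lambda>\<omega>. X \<omega> * (X \<omega> - Y \<omega>) * D (X \<omega> + Y \<omega>))"
  shows "expectation (\<lambda>\<omega>. X \<omega> * f (X \<omega> + Y \<omega>)) =
    expectation (\<lambda>\<omega>. X \<omega> * (X \<omega> - Y \<omega>) * D (X \<omega> + Y \<omega>))"
proof (rule LIMSEQ_unique)
  have f_meas [measurable]: "f \<in> borel_measurable borel"
    using f lipschitz_real_measurable unfolding lipschitz_real_def by blast
  define S where "S \<omega> = X \<omega> + Y \<omega>" for \<omega>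
  have S_meas [measurable]: "S \<in> borel_measurable M"
    unfolding S_def by measurable
  define \<phi> where "\<phi> n = cutoff (real (Suc n))" for n
  define \<psi> where "\<psi> n = cutoff_deriv (real (Suc n))" for n
  have \<phi>_meas [measurable]: "\<phi> n \<in> borel_measurable borel" and \<psi>_meas [measurable]: "\<psi> n \<in> borel_measurable borel" for n
    unfolding \<phi>_def \<psi>_def by measurable
  have \<phi>: "\<bar>\<phi> n u\<bar> \<le> 1" "(\<lambda>n. \<phi> n u) \<longlonglongrightarrow> 1" and \<psi>: "(\<lambda>n. \<psi> n u) \<longlonglongrightarrow> 0" for n u
    unfolding \<phi>_def \<psi>_def using cutoff_bounds[of "real (Suc n)" u] cutoff_tendsto[of u] by auto
  show "(\<lambda>n. expectation (\<lambda>\<omega>. X \<omega> * (f (S \<omega>) * \<phi> n (S \<omega>)))) \<longlonglongrightarrow>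
      expectation (\<lambda>\<omega>. X \<omega> * f (X \<omega> + Y \<omega>))"
  proof (rule integral_dominated_convergence)
    show "integrable M (\<lambda>\<omega>. \<bar>X \<omega> * f (X \<omega> + Y \<omega>)\<bar>)"
      using int_f by simp
    show "AE \<omega> in M. (\<lambda>n. X \<omega> * (f (S \<omega>) * \<phi> n (S \<omega>))) \<longlonglongrightarrow> X \<omega> * f (X \<omega> + Y \<omega>)"
    proof (rule AE_I2)
      fix \<omega>
      have "(\<lambda>n. X \<omega> * (f (S \<omega>) * \<phi> n (S \<omega>))) \<longlonglongrightarrow> X \<omega> * (f (S \<omega>) * 1)"
        by (intro tendsto_intros \<phi>)
      thus "(\<lambda>n. X \<omega> * (f (S \<omega>) * \<phi> n (S \<omega>))) \<longlonglongrightarrow> X \<omega> * f (X \<omega> + Y \<omega>)"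
        unfolding S_def by simp
    qed
    show "AE \<omega> in M. norm (X \<omega> * (f (S \<omega>) * \<phi> n (S \<omega>))) \<le> \<bar>X \<omega> * f (X \<omega> + Y \<omega>)\<bar>" for n
    proof (rule AE_I2)
      fix \<omega>
      have "\<bar>X \<omega> * f (S \<omega>)\<bar> * \<bar>\<phi> n (S \<omega>)\<bar> \<le> \<bar>X \<omega> * f (S \<omega>)\<bar> * 1"
        by (rule mult_left_mono[OF \<phi>(1)]) simp
      thus "norm (X \<omega> * (f (S \<omega>) * \<phi> n (S \<omega>))) \<le> \<bar>X \<omega> * f (X \<omega> + Y \<omega>)\<bar>"
        unfolding S_def by (simp add: abs_mult mult.assoc)
    qed
  qed measurable
  have "(\<lambda>n. expectation (\<lambda>\<omega>. X \<omega> * (X \<omega> - Y \<omega>) *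
        (D (S \<omega>) * \<phi> n (S \<omega>) + f (S \<omega>) * \<psi> n (S \<omega>)))) \<longlonglongrightarrow>
      expectation (\<lambda>\<omega>. X \<omega> * (X \<omega> - Y \<omega>) * D (X \<omega> + Y \<omega>))"
  proof (rule integral_dominated_convergence)
    show "integrable M (\<lambda>\<omega>. \<bar>X \<omega> * (X \<omega> - Y \<omega>) * D (X \<omega> + Y \<omega>)\<bar> +
        (8 * (\<bar>f 0\<bar> + L) * (X \<omega>)\<^sup>2 + 4 * \<bar>X \<omega> * f (X \<omega> + Y \<omega>)\<bar>))"
      by (intro Bochner_Integration.integrable_add integrable_mult_right integrable_abs
          int_f int_D X_square_integrable)
    show "AE \<omega> in M. (\<lambda>n. X \<omega> * (X \<omega> - Y \<omega>) * (D (S \<omega>) * \<phi> n (S \<omega>) + f (S \<omega>) * \<psi> n (S \<omega>)))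
        \<longlonglongrightarrow> X \<omega> * (X \<omega> - Y \<omega>) * D (X \<omega> + Y \<omega>)"
    proof (rule AE_I2)
      fix \<omega>
      have "(\<lambda>n. X \<omega> * (X \<omega> - Y \<omega>) * (D (S \<omega>) * \<phi> n (S \<omega>) + f (S \<omega>) * \<psi> n (S \<omega>)))
          \<longlonglongrightarrow> X \<omega> * (X \<omega> - Y \<omega>) * (D (S \<omega>) * 1 + f (S \<omega>) * 0)"
        by (intro tendsto_intros \<phi> \<psi>)
      thus "(\<lambda>n. X \<omega> * (X \<omega> - Y \<omega>) * (D (S \<omega>) * \<phi> n (S \<omega>) + f (S \<omega>) * \<psi> n (S \<omega>)))
          \<longlonglongrightarrow> X \<omega> * (X \<omega> - Y \<omega>) * D (X \<omega> + Y \<omega>)"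
        unfolding S_def by simp
    qed
    show "AE \<omega> in M. norm (X \<omega> * (X \<omega> - Y \<omega>) * (D (S \<omega>) * \<phi> n (S \<omega>) + f (S \<omega>) * \<psi> n (S \<omega>))) \<le>
        \<bar>X \<omega> * (X \<omega> - Y \<omega>) * D (X \<omega> + Y \<omega>)\<bar> +
        (8 * (\<bar>f 0\<bar> + L) * (X \<omega>)\<^sup>2 + 4 * \<bar>X \<omega> * f (X \<omega> + Y \<omega>)\<bar>)" for n
    proof (rule AE_I2)
      fix \<omega>
      have "norm (X \<omega> * (X \<omega> - Y \<omega>) * (D (S \<omega>) * \<phi> n (S \<omega>) + f (S \<omega>) * \<psi> n (S \<omega>))) \<le>
          \<bar>X \<omega> * (X \<omega> - Y \<omega>) * (D (S \<omega>) * \<phi> n (S \<omega>))\<bar> +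
          \<bar>X \<omega> * (X \<omega> - Y \<omega>) * (f (S \<omega>) * \<psi> n (S \<omega>))\<bar>"
        unfolding distrib_left real_norm_def by (rule abs_triangle_ineq)
      moreover have "\<bar>X \<omega> * (X \<omega> - Y \<omega>) * (D (S \<omega>) * \<phi> n (S \<omega>))\<bar> \<le>
          \<bar>X \<omega> * (X \<omega> - Y \<omega>) * D (S \<omega>)\<bar>"
      proof -
        have "\<bar>X \<omega> * (X \<omega> - Y \<omega>) * D (S \<omega>)\<bar> * \<bar>\<phi> n (S \<omega>)\<bar> \<le>
            \<bar>X \<omega> * (X \<omega> - Y \<omega>) * D (S \<omega>)\<bar> * 1"
          by (rule mult_left_mono[OF \<phi>(1)]) simp
        thus ?thesis
          by (simp add: abs_mult mult.assoc)
      qed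
      moreover have "\<bar>X \<omega> * (X \<omega> - Y \<omega>) * (f (S \<omega>) * \<psi> n (S \<omega>))\<bar> \<le>
          8 * (\<bar>f 0\<bar> + L) * (X \<omega>)\<^sup>2 + 4 * \<bar>X \<omega> * f (S \<omega>)\<bar>"
        unfolding \<psi>_def S_def by (rule cutoff_error_bound[OF f]) simp
      ultimately show "norm (X \<omega> * (X \<omega> - Y \<omega>) * (D (S \<omega>) * \<phi> n (S \<omega>) + f (S \<omega>) * \<psi> n (S \<omega>))) \<le>
          \<bar>X \<omega> * (X \<omega> - Y \<omega>) * D (X \<omega> + Y \<omega>)\<bar> +
          (8 * (\<bar>f 0\<bar> + L) * (X \<omega>)\<^sup>2 + 4 * \<bar>X \<omega> * f (X \<omega> + Y \<omega>)\<bar>)"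
        unfolding S_def by linarith
    qed
  qed measurable
  thus "(\<lambda>n. expectation (\<lambda>\<omega>. X \<omega> * (f (S \<omega>) * \<phi> n (S \<omega>)))) \<longlonglongrightarrow>
      expectation (\<lambda>\<omega>. X \<omega> * (X \<omega> - Y \<omega>) * D (X \<omega> + Y \<omega>))"
    unfolding S_def \<phi>_def \<psi>_def by (subst truncated_identity[OF f fD D_meas D]) simp_all
qed

end

theorem lemma2p4:
  fixes M :: "'a measure" and X Y :: "'a \<Rightarrow> real"
  assumes "prob_space M"
    and "X \<in> borel_measurable M"
    and "integrable M X" and "prob_space.expectation M X = 0"
    and "integrable M (\<lambda>\<omega>. (X \<omega>)\<^sup>2)" and "prob_space.variance M X \<noteq> 0"
    and "prob_space.indep_var M borel X borel Y"
    and "has_zero_bias_distribution M X M Y"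
  shows "\<forall>f f'. lipschitz_real f \<longrightarrow> ae_derivative f f' \<longrightarrow>
    integrable M (\<lambda>\<omega>. X \<omega> * f (X \<omega> + Y \<omega>)) \<longrightarrow>
    integrable M (\<lambda>\<omega>. ((X \<omega>)\<^sup>2 - X \<omega> * Y \<omega>) * f' (X \<omega> + Y \<omega>)) \<longrightarrow>
    prob_space.expectation M (\<lambda>\<omega>. X \<omega> * f (X \<omega> + Y \<omega>)) =
      prob_space.expectation M (\<lambda>\<omega>. ((X \<omega>)\<^sup>2 - X \<omega> * Y \<omega>) * f' (X \<omega> + Y \<omega>))"
proof (intro allI impI)
  fix f f' :: "real \<Rightarrow> real"
  assume f: "lipschitz_real f" and f': "ae_derivative f f'"
    and int_f: "integrable M (\<lambda>\<omega>. X \<omega> * f (X \<omega> + Y \<omega>))"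
    and int_f': "integrable M (\<lambda>\<omega>. ((X \<omega>)\<^sup>2 - X \<omega> * Y \<omega>) * f' (X \<omega> + Y \<omega>))"
  interpret independent_zero_bias M X Y
    by (intro independent_zero_bias.intro independent_zero_bias_axioms.intro assms)
  obtain L where L: "L-lipschitz_on UNIV f"
    using f unfolding lipschitz_real_def by blast
  obtain D where D: "D \<in> borel_measurable borel" "\<And>x. \<bar>D x\<bar> \<le> L"
      "AE x in lborel. D x = f' x" "ae_derivative f D"
    using bounded_borel_derivative[OF L f'] by blast
  note D(1)[measurable]
  have eq: "AE \<omega> in M. ((X \<omega>)\<^sup>2 - X \<omega> * Y \<omega>) * f' (X \<omega> + Y \<omega>) =
      X \<omega> * (X \<omega> - Y \<omega>) * D (X \<omega> + Y \<omega>)"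
    using sum_absolutely_continuous[OF D(3)]
    by (rule eventually_mono) (simp add: power2_eq_square right_diff_distrib)
  have int_D: "integrable M (\<lambda>\<omega>. X \<omega> * (X \<omega> - Y \<omega>) * D (X \<omega> + Y \<omega>))"
    by (rule integrable_cong_AE_imp[OF int_f']) (use eq in \<open>auto simp: eq_commute\<close>)
  have "expectation (\<lambda>\<omega>. X \<omega> * f (X \<omega> + Y \<omega>)) =
      expectation (\<lambda>\<omega>. X \<omega> * (X \<omega> - Y \<omega>) * D (X \<omega> + Y \<omega>))"
    by (rule identity_for_borel_derivative[OF L D(4,1,2) int_f int_D])
  also have "\<dots> = expectation (\<lambda>\<omega>. ((X \<omega>)\<^sup>2 - X \<omega> * Y \<omega>) * f' (X \<omega> + Y \<omega>))"
    using eq int_f' int_D by (intro integral_cong_AE) (auto simp: eq_commute)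
  finally show "expectation (\<lambda>\<omega>. X \<omega> * f (X \<omega> + Y \<omega>)) =
      expectation (\<lambda>\<omega>. ((X \<omega>)\<^sup>2 - X \<omega> * Y \<omega>) * f' (X \<omega> + Y \<omega>))" .
qed

end
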